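(* Let $G=(S,T,\pi)$ be a two-person win-lose game (with $S,T$ arbitrary non-empty sets). Then $G$ is totally minimax if and only if $G$ is LNG-free.
   Context: A two-person win-lose game is a triple $G=(S,T,\pi)$ where $S,T$ are non-empty sets (possibly infinite, of any cardinality) and $\pi:S\times T\to\{0,1\}$. For a set $X$, $\Delta(X)$ denotes the set of probability distributions $\mathbf{p}=(p_x)_{x\in X}$ on $X$ with at most countable support. For $\mathbf{p}\in\Delta(S)$, $\mathbf{q}\in\Delta(T)$, $\pi^{\mathrm{mix}}(\mathbf{p},\mathbf{q})=\sum_{s,t}p_sq_t\pi(s,t)$. $G$ satisfies the minimax property if $\sup_{\mathbf{p}\in\Delta(S)}\inf_{\mathbf{q}\in\Delta(T)}\pi^{\mathrm{mix}}(\mathbf{p},\mathbf{q})=\inf_{\mathbf{q}\in\Delta(T)}\sup_{\mathbf{p}\in\Delta(S)}\pi^{\mathrm{mix}}(\mathbf{p},\mathbf{q})$. A subgame of $G$ is a game $(S',T',\pi')$ with non-empty $S'\subseteq S$, $T'\subseteq T$ and $\pi'=\pi|_{S'\times T'}$. $G$ is totally minimax if every subgame of $G$ satisfies the minimax property. The larger number game (LNG) is $(\mathbb{N},\mathbb{N},\pi)$ with $\pi(s,t)=1$ iff $s\ge t$. $G$ is LNG-free if no subgame of $G$ is isomorphic to LNG, i.e., there are no sequences $s_1,s_2,\ldots$ in $S$ and $t_1,t_2,\ldots$ in $T$ (each consisting of distinct elements) with $\pi(s_i,t_j)=1\iff i\ge j$. *)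

theory Defs
  imports "HOL-Analysis.Analysis"
begin

text \<open>A win-lose game is given by strategy sets S, T and a payoff relation
  \<pi> :: 'a \<Rightarrow> 'b \<Rightarrow> bool (True = payoff 1, False = payoff 0).\<close>

definition distr :: "'a set \<Rightarrow> ('a \<Rightarrow> real) set" where
  "distr X = {p. (\<forall>x. 0 \<le> p x) \<and> (\<forall>x. x \<notin> X \<longrightarrow> p x = 0)
                 \<and> countable {x. p x \<noteq> 0} \<and> (p has_sum 1) X}"

definition mix :: "('a \<Rightarrow> 'b \<Rightarrow> bool) \<Rightarrow> 'a set \<Rightarrow> 'b set \<Rightarrow> ('a \<Rightarrow> real) \<Rightarrow> ('b \<Rightarrow> real) \<Rightarrow> real" where
  "mix \<pi> S T p q = (\<Sum>\<^sub>\<infinity>(s,t)\<in>S \<times> T. p s * q t * of_bool (\<pi> s t))"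

definition minimax_property :: "'a set \<Rightarrow> 'b set \<Rightarrow> ('a \<Rightarrow> 'b \<Rightarrow> bool) \<Rightarrow> bool" where
  "minimax_property S T \<pi> \<longleftrightarrow>
     (SUP p\<in>distr S. INF q\<in>distr T. mix \<pi> S T p q) =
     (INF q\<in>distr T. SUP p\<in>distr S. mix \<pi> S T p q)"

definition totally_minimax :: "'a set \<Rightarrow> 'b set \<Rightarrow> ('a \<Rightarrow> 'b \<Rightarrow> bool) \<Rightarrow> bool" where
  "totally_minimax S T \<pi> \<longleftrightarrow>
     (\<forall>S' T'. S' \<noteq> {} \<longrightarrow> S' \<subseteq> S \<longrightarrow> T' \<noteq> {} \<longrightarrow> T' \<subseteq> T \<longrightarrow> minimax_property S' T' \<pi>)"

definition LNG_free :: "'a set \<Rightarrow> 'b set \<Rightarrow> ('a \<Rightarrow> 'b \<Rightarrow> bool) \<Rightarrow> bool" where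
  "LNG_free S T \<pi> \<longleftrightarrow>
     \<not> (\<exists>s :: nat \<Rightarrow> 'a. \<exists>t :: nat \<Rightarrow> 'b. inj s \<and> inj t \<and> range s \<subseteq> S \<and> range t \<subseteq> T \<and>
           (\<forall>i j. \<pi> (s i) (t j) \<longleftrightarrow> j \<le> i))"

end

theory Submission
  imports Defs "HOL-Library.Diagonal_Subsequence" "HOL-Library.Multiset"
begin

text \<open>
  The hard direction bounds the upper value by the lower value for an LNG-free game. First, suppose
  every finite set of rows is beaten by a single column. Call a set of rows null if, even using only
  columns that beat a prescribed finite set of rows, some mixed column holds all its rows to at most
  \<open>\<epsilon>\<close>. A non-null set stays non-null when it is cut down to the rows that win against some column of
  a suitable finite set: otherwise one could average many mixed columns, each of them small on the
  rows hit by its predecessors. Iterating this and applying a diagonal argument produces the larger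
  number game. Hence the upper value is 0.

  In general, pass to a countable subgame. By compactness, the mixed columns that are optimal against
  finite sets of rows have a limit \<open>l\<close>, a finitely additive probability on columns with
  \<open>l {t. \<pi> s t} \<le> a\<close> for all rows \<open>s\<close>. Enumerate the uniform distributions \<open>Q k\<close> on finite multisets of
  columns. By the value 0 case, the columns are covered by finitely many sets on which \<open>Q k\<close> is, up to
  an \<open>l\<close>-small error, dominated by the column itself plus \<open>\<epsilon>\<close>; replacing each column by the
  corresponding \<open>Q k\<close> turns \<open>l\<close> into a genuine mixed column with almost the same guarantees.
\<close>

subsection \<open>Uniform mixtures of finitely many columns\<close>

definition freq :: "('b \<Rightarrow> bool) \<Rightarrow> 'b multiset \<Rightarrow> real" where
  "freq P M = size (filter_mset P M) / size M"

definition samples :: "'b set \<Rightarrow> 'b multiset set" where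
  "samples T = {M. M \<noteq> {#} \<and> set_mset M \<subseteq> T}"

definition can_hold :: "('a \<Rightarrow> 'b \<Rightarrow> bool) \<Rightarrow> 'b set \<Rightarrow> 'a set \<Rightarrow> real \<Rightarrow> bool" where
  "can_hold \<pi> T A c \<longleftrightarrow> (\<exists>M\<in>samples T. \<forall>s\<in>A. freq (\<pi> s) M \<le> c)"

lemma freq_nonneg: "0 \<le> freq P M"
  by (simp add: freq_def)

lemma freq_le_1: "freq P M \<le> 1"
  by (simp add: freq_def divide_le_eq)

lemma freq_pos_iff: "0 < freq P M \<longleftrightarrow> (\<exists>t\<in>#M. P t)"
  by (auto simp: freq_def zero_less_divide_iff nonempty_has_size[symmetric] filter_mset_eq_conv)

lemma samples_mono: "T \<subseteq> T' \<Longrightarrow> samples T \<subseteq> samples T'"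
  by (auto simp: samples_def)

lemma countable_samples:
  assumes "countable T"
  shows "countable (samples T)"
proof (rule countable_subset)
  show "samples T \<subseteq> mset ` lists T"
  proof
    fix M assume M: "M \<in> samples T"
    obtain xs where "M = mset xs" using ex_mset[of M] by auto
    then show "M \<in> mset ` lists T" using M by (auto simp: samples_def)
  qed
qed (use assms in simp)

lemma can_hold_mono:
  assumes "can_hold \<pi> T A c" "T \<subseteq> T'" "A' \<subseteq> A" "c \<le> c'"
  shows "can_hold \<pi> T' A' c'"
  using assms samples_mono[OF assms(2)] unfolding can_hold_def by (meson order_trans subsetD)

lemma size_filter_mset_sum:
  "size (filter_mset P (\<Sum>i\<in>I. M i)) = (\<Sum>i\<in>I. size (filter_mset P (M i)))"
  by (induction I rule: infinite_finite_induct) auto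

lemma in_repeat_mset_iff: "x \<in># repeat_mset n M \<longleftrightarrow> 0 < n \<and> x \<in># M"
  by (induction n) auto

lemma size_filter_repeat_mset: "size (filter_mset P (repeat_mset n M)) = n * size (filter_mset P M)"
  by (induction n) auto

lemma repeat_mset_rounding:
  fixes w :: real
  assumes "M \<noteq> {#}" "0 \<le> w"
  obtains m where "w \<le> size (repeat_mset m M)"
    "\<And>P. size (filter_mset P (repeat_mset m M)) \<le> w * freq P M + size M"
proof -
  define m where "m = nat \<lceil>w / size M\<rceil>"
  have "w / size M \<le> m" unfolding m_def by linarith
  then have "w \<le> size (repeat_mset m M)"
    using \<open>M \<noteq> {#}\<close> by (simp add: divide_le_eq nonempty_has_size)
  moreover have "size (filter_mset P (repeat_mset m M)) \<le> w * freq P M + size M" for P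
  proof -
    have "0 \<le> w / size M" using \<open>0 \<le> w\<close> by simp
    then have "m \<le> w / size M + 1" unfolding m_def by linarith
    then have "real m * size (filter_mset P M) \<le> (w / size M + 1) * size (filter_mset P M)"
      by (intro mult_right_mono) auto
    also have "\<dots> = w * freq P M + size (filter_mset P M)"
      by (simp add: freq_def distrib_right)
    also have "\<dots> \<le> w * freq P M + size M" by simp
    finally show ?thesis by (simp add: size_filter_repeat_mset)
  qed
  ultimately show thesis by (rule that)
qed

lemma freq_mixture:
  fixes \<nu> :: "'i \<Rightarrow> real" and Q :: "'i \<Rightarrow> 'b multiset"
  assumes "finite I" and \<nu>: "\<And>i. i \<in> I \<Longrightarrow> 0 \<le> \<nu> i" "sum \<nu> I = 1"
    and Q: "\<And>i. i \<in> I \<Longrightarrow> Q i \<in> samples T" and "0 < \<delta>"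
  shows "\<exists>M\<in>samples T. \<forall>P. freq P M \<le> (\<Sum>i\<in>I. \<nu> i * freq P (Q i)) + \<delta>"
proof -
  define L where "L = (\<Sum>i\<in>I. size (Q i))"
  obtain N :: nat where N: "L < N * \<delta>" using reals_Archimedean3[OF \<open>0 < \<delta>\<close>] by blast
  then have "0 < N" by (cases N) auto
  have "\<exists>m. N * \<nu> i \<le> size (repeat_mset m (Q i)) \<and>
      (\<forall>P. size (filter_mset P (repeat_mset m (Q i))) \<le> N * \<nu> i * freq P (Q i) + size (Q i))"
    if "i \<in> I" for i
    by (rule repeat_mset_rounding[of "Q i" "N * \<nu> i"])
      (use \<nu>(1)[OF that] Q[OF that] in \<open>auto simp: samples_def\<close>)
  then obtain m where lower: "\<And>i. i \<in> I \<Longrightarrow> N * \<nu> i \<le> size (repeat_mset (m i) (Q i))"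
    and upper: "\<And>i P. i \<in> I \<Longrightarrow> size (filter_mset P (repeat_mset (m i) (Q i)))
      \<le> N * \<nu> i * freq P (Q i) + size (Q i)"
    by metis
  define M where "M = (\<Sum>i\<in>I. repeat_mset (m i) (Q i))"
  have "real N = (\<Sum>i\<in>I. N * \<nu> i)" by (simp add: \<nu>(2) flip: sum_distrib_left)
  also have "\<dots> \<le> size M"
    unfolding M_def size_multiset_sum of_nat_sum by (intro sum_mono lower)
  finally have size_M: "N \<le> size M" by simp
  have "freq P M \<le> (\<Sum>i\<in>I. \<nu> i * freq P (Q i)) + \<delta>" (is "_ \<le> ?avg + \<delta>") for P
  proof -
    have "real (size (filter_mset P M)) \<le> (\<Sum>i\<in>I. N * \<nu> i * freq P (Q i) + size (Q i))"
      unfolding M_def size_filter_mset_sum of_nat_sum by (intro sum_mono upper)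
    also have "\<dots> = N * ?avg + L"
      by (simp add: sum.distrib sum_distrib_left L_def mult.assoc)
    also have "\<dots> \<le> N * (?avg + \<delta>)" using N by (simp add: distrib_left)
    also have "\<dots> \<le> size M * (?avg + \<delta>)"
      using size_M \<nu>(1) \<open>0 < \<delta>\<close>
      by (intro mult_right_mono add_nonneg_nonneg sum_nonneg) (auto simp: freq_nonneg)
    finally show ?thesis
      using size_M \<open>0 < N\<close> unfolding freq_def[of P M] by (simp add: divide_le_eq mult.commute)
  qed
  moreover have "M \<in> samples T"
  proof -
    have "set_mset M \<subseteq> (\<Union>i\<in>I. set_mset (Q i))"
      using \<open>finite I\<close> by (auto simp: M_def set_mset_sum in_repeat_mset_iff)
    then show ?thesis using Q size_M \<open>0 < N\<close> by (fastforce simp: samples_def)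
  qed
  ultimately show ?thesis by blast
qed

subsection \<open>Finitely many rows\<close>

text \<open>Blackwell's strategy: answering the positive parts of the accumulated sums
  makes the sum of their squares grow at most linearly.\<close>

lemma blackwell_approachability:
  fixes v :: "'b \<Rightarrow> 'a \<Rightarrow> real" and c :: real
  assumes bound: "\<And>t s. t \<in> T \<Longrightarrow> s \<in> B \<Longrightarrow> \<bar>v t s\<bar> \<le> c"
    and response: "\<And>w. (\<And>s. s \<in> B \<Longrightarrow> 0 \<le> w s) \<Longrightarrow> \<exists>t\<in>T. (\<Sum>s\<in>B. w s * v t s) \<le> 0"
  shows "\<exists>M. size M = n \<and> set_mset M \<subseteq> T \<and>
    (\<Sum>s\<in>B. (max 0 (\<Sum>t\<in>#M. v t s))\<^sup>2) \<le> n * (card B * c\<^sup>2)"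
proof (induction n)
  case 0
  show ?case by (intro exI[of _ "{#}"]) simp
next
  case (Suc n)
  then obtain M where M: "size M = n" "set_mset M \<subseteq> T"
    and potential: "(\<Sum>s\<in>B. (max 0 (\<Sum>t\<in>#M. v t s))\<^sup>2) \<le> n * (card B * c\<^sup>2)"
    by blast
  define w where "w s = max 0 (\<Sum>t\<in>#M. v t s)" for s
  obtain t where t: "t \<in> T" "(\<Sum>s\<in>B. w s * v t s) \<le> 0"
    using response[of w] by (auto simp: w_def)
  have increment: "(max 0 (\<Sum>u\<in>#add_mset t M. v u s))\<^sup>2 \<le> (w s)\<^sup>2 + 2 * (w s * v t s) + c\<^sup>2"
    if "s \<in> B" for s
  proof -
    have "\<bar>max 0 (\<Sum>u\<in>#add_mset t M. v u s)\<bar> \<le> \<bar>w s + v t s\<bar>"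
      by (auto simp: w_def)
    then have "(max 0 (\<Sum>u\<in>#add_mset t M. v u s))\<^sup>2 \<le> (w s + v t s)\<^sup>2"
      by (simp only: abs_le_square_iff)
    moreover have "(v t s)\<^sup>2 \<le> c\<^sup>2"
      using bound[OF t(1) that] by (simp add: abs_le_square_iff[symmetric])
    ultimately show ?thesis by (simp add: power2_sum)
  qed
  have "(\<Sum>s\<in>B. (max 0 (\<Sum>u\<in>#add_mset t M. v u s))\<^sup>2)
      \<le> (\<Sum>s\<in>B. (w s)\<^sup>2 + 2 * (w s * v t s) + c\<^sup>2)"
    by (intro sum_mono increment)
  also have "\<dots> = (\<Sum>s\<in>B. (w s)\<^sup>2) + 2 * (\<Sum>s\<in>B. w s * v t s) + card B * c\<^sup>2"
    by (simp add: sum.distrib sum_distrib_left)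
  also have "\<dots> \<le> Suc n * (card B * c\<^sup>2)"
    using potential t(2) by (simp add: w_def algebra_simps)
  finally show ?case using M t(1) by (intro exI[of _ "add_mset t M"]) auto
qed

lemma bounded_approachability:
  fixes v :: "'b \<Rightarrow> 'a \<Rightarrow> real" and c \<delta> :: real
  assumes "finite B" and bound: "\<And>t s. t \<in> T \<Longrightarrow> s \<in> B \<Longrightarrow> \<bar>v t s\<bar> \<le> c"
    and response: "\<And>w. (\<And>s. s \<in> B \<Longrightarrow> 0 \<le> w s) \<Longrightarrow> \<exists>t\<in>T. (\<Sum>s\<in>B. w s * v t s) \<le> 0"
    and "0 < \<delta>"
  shows "\<exists>M\<in>samples T. \<forall>s\<in>B. (\<Sum>t\<in>#M. v t s) \<le> \<delta> * size M"
proof -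
  obtain n :: nat where n: "card B * c\<^sup>2 / \<delta>\<^sup>2 \<le> n" "0 < n"
    using reals_Archimedean2[of "max 1 (card B * c\<^sup>2 / \<delta>\<^sup>2)"]
    by (metis less_eq_real_def max_less_iff_conj of_nat_0_less_iff less_trans zero_less_one)
  obtain M where M: "size M = n" "set_mset M \<subseteq> T"
    and potential: "(\<Sum>s\<in>B. (max 0 (\<Sum>t\<in>#M. v t s))\<^sup>2) \<le> n * (card B * c\<^sup>2)"
    using blackwell_approachability[of T B v c n] bound response by blast
  have "(\<Sum>t\<in>#M. v t s) \<le> \<delta> * size M" if "s \<in> B" for s
  proof -
    have "(max 0 (\<Sum>t\<in>#M. v t s))\<^sup>2 \<le> (\<Sum>s\<in>B. (max 0 (\<Sum>t\<in>#M. v t s))\<^sup>2)"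
      using that \<open>finite B\<close> by (intro member_le_sum) auto
    also have "\<dots> \<le> n * (card B * c\<^sup>2)" by (fact potential)
    also have "\<dots> \<le> n * (n * \<delta>\<^sup>2)"
      using n(1) \<open>0 < \<delta>\<close> by (intro mult_left_mono) (auto simp: field_simps)
    also have "\<dots> = (\<delta> * size M)\<^sup>2" by (simp add: M(1) power2_eq_square)
    finally have "max 0 (\<Sum>t\<in>#M. v t s) \<le> \<delta> * size M"
      by (rule power2_le_imp_le) (use \<open>0 < \<delta>\<close> in simp)
    then show ?thesis by simp
  qed
  moreover have "M \<in> samples T" using M n(2) by (auto simp: samples_def)
  ultimately show ?thesis by blast
qed

lemma finite_rows_minimax:
  fixes \<pi> :: "'a \<Rightarrow> 'b \<Rightarrow> bool"
  assumes "finite B" "T \<noteq> {}" "a < c"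
    and response: "\<And>p. (\<And>s. s \<in> B \<Longrightarrow> 0 \<le> p s) \<Longrightarrow> sum p B = 1 \<Longrightarrow>
      \<exists>t\<in>T. (\<Sum>s\<in>B. p s * of_bool (\<pi> s t)) \<le> a"
  shows "can_hold \<pi> T B c"
proof -
  have unnormalized: "\<exists>t\<in>T. (\<Sum>s\<in>B. w s * (of_bool (\<pi> s t) - a)) \<le> 0"
    if w: "\<And>s. s \<in> B \<Longrightarrow> 0 \<le> w s" for w
  proof (cases "sum w B = 0")
    case True
    then have "\<forall>s\<in>B. w s = 0"
      using w \<open>finite B\<close> by (simp add: sum_nonneg_eq_0_iff)
    then show ?thesis using \<open>T \<noteq> {}\<close> by auto
  next
    case False
    then have pos: "0 < sum w B" using sum_nonneg[of B w] w by fastforce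
    obtain t where t: "t \<in> T" "(\<Sum>s\<in>B. w s / sum w B * of_bool (\<pi> s t)) \<le> a"
      using response[of "\<lambda>s. w s / sum w B"] w pos by (auto simp flip: sum_divide_distrib)
    have "(\<Sum>s\<in>B. w s * of_bool (\<pi> s t)) / sum w B \<le> a"
      using t(2) unfolding sum_divide_distrib by simp
    then have "(\<Sum>s\<in>B. w s * of_bool (\<pi> s t)) \<le> a * sum w B"
      using pos by (simp add: divide_le_eq)
    then show ?thesis
      using t(1) by (auto simp: right_diff_distrib sum_subtractf sum_distrib_left mult.commute)
  qed
  have bound: "\<bar>of_bool (\<pi> s t) - a\<bar> \<le> 1 + \<bar>a\<bar>" for s t
    by auto
  obtain M where M: "M \<in> samples T"
    and excess: "\<And>s. s \<in> B \<Longrightarrow> (\<Sum>t\<in>#M. of_bool (\<pi> s t) - a) \<le> (c - a) * size M"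
    using bounded_approachability[OF \<open>finite B\<close> bound unnormalized, of "c - a"] \<open>a < c\<close> by auto
  have excess_eq: "(\<Sum>t\<in>#M. of_bool (P t) - a) = size (filter_mset P M) - a * size M" for P M
    by (induction M) (auto simp: algebra_simps)
  have "freq (\<pi> s) M \<le> c" if "s \<in> B" for s
    using excess[OF that] M unfolding excess_eq
    by (simp add: freq_def samples_def divide_le_eq algebra_simps nonempty_has_size)
  then show ?thesis using M by (auto simp: can_hold_def)
qed

subsection \<open>Extracting the larger number game\<close>

lemma diagonal_eventually_const:
  fixes h :: "nat \<Rightarrow> nat \<Rightarrow> 'c"
  assumes "\<And>k. finite (F k)" and "\<And>k. \<forall>\<^sub>F i in sequentially. h i k \<in> F k"
  obtains r f where "strict_mono r" "\<And>k. f k \<in> F k" "\<And>k. \<forall>\<^sub>F i in sequentially. h (r i) k = f k"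
proof -
  interpret subseqs "\<lambda>k r. \<exists>c\<in>F k. \<forall>\<^sub>F i in sequentially. h (r i) k = c"
  proof
    fix k and r :: "nat \<Rightarrow> nat" assume "strict_mono r"
    then have "\<forall>\<^sub>F i in sequentially. h (r i) k \<in> F k"
      by (rule eventually_subseq) (rule assms(2))
    then obtain N where N: "\<And>i. N \<le> i \<Longrightarrow> h (r i) k \<in> F k"
      by (auto simp: eventually_sequentially)
    have "\<exists>c\<in>F k. infinite {i \<in> {N..}. h (r i) k = c}"
      using N by (intro pigeonhole_infinite_rel assms(1)) (auto simp: infinite_Ici)
    then obtain c where "c \<in> F k" and inf: "infinite {i \<in> {N..}. h (r i) k = c}" ..
    obtain r' :: "nat \<Rightarrow> nat" where "strict_mono r'" and "\<forall>n. r' n \<in> {i \<in> {N..}. h (r i) k = c}"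
      using infinite_enumerate[OF inf] by blast
    from this(2) have "\<forall>\<^sub>F i in sequentially. h ((r \<circ> r') i) k = c" by simp
    with \<open>strict_mono r'\<close> \<open>c \<in> F k\<close>
    show "\<exists>r'. strict_mono r' \<and> (\<exists>c\<in>F k. \<forall>\<^sub>F i in sequentially. h ((r \<circ> r') i) k = c)"
      by blast
  qed
  have "\<exists>c\<in>F k. \<forall>\<^sub>F i in sequentially. h (diagseq i) k = c" for k
  proof -
    obtain c where "c \<in> F k" "\<forall>\<^sub>F i in sequentially. h ((diagseq \<circ> (+) (Suc k)) i) k = c"
      using diagseq_holds[of k] by (auto dest: eventually_subseq)
    from this(2) have "\<forall>\<^sub>F i in sequentially. h (diagseq (i + Suc k)) k = c"
      by (simp add: add.commute)
    then have "\<forall>\<^sub>F i in sequentially. h (diagseq i) k = c"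
      by (subst (asm) eventually_sequentially_seg)
    then show ?thesis using \<open>c \<in> F k\<close> by blast
  qed
  then have "\<forall>k. \<exists>c. c \<in> F k \<and> (\<forall>\<^sub>F i in sequentially. h (diagseq i) k = c)"
    by blast
  then obtain f where "\<forall>k. f k \<in> F k \<and> (\<forall>\<^sub>F i in sequentially. h (diagseq i) k = f k)"
    by (rule exE[OF choice])
  then show thesis by (intro that[OF subseq_diagseq, of f]) simp_all
qed

lemma not_LNG_freeI:
  fixes s :: "nat \<Rightarrow> 'a" and t :: "nat \<Rightarrow> 'b"
  assumes "\<And>i. s i \<in> S" "\<And>j. t j \<in> T" and pattern: "\<And>i j. \<pi> (s i) (t j) \<longleftrightarrow> j \<le> i"
  shows "\<not> LNG_free S T \<pi>"
proof -
  have "inj s"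
  proof (rule injI)
    fix i i' assume "s i = s i'"
    then have "j \<le> i \<longleftrightarrow> j \<le> i'" for j using pattern by metis
    then show "i = i'" by (meson order.refl order.antisym)
  qed
  moreover have "inj t"
  proof (rule injI)
    fix j j' assume "t j = t j'"
    then have "j \<le> i \<longleftrightarrow> j' \<le> i" for i using pattern by metis
    then show "j = j'" by (meson order.refl order.antisym)
  qed
  ultimately show ?thesis
    unfolding LNG_free_def using assms by (simp add: image_subset_iff) blast
qed

lemma not_LNG_free_eventuallyI:
  fixes s :: "nat \<Rightarrow> 'a" and t :: "nat \<Rightarrow> 'b"
  assumes "\<And>i. s i \<in> S" "\<And>j. t j \<in> T"
    and hit: "\<And>j. \<forall>\<^sub>F i in sequentially. \<pi> (s i) (t j)"
    and miss: "\<And>i j. i < j \<Longrightarrow> \<not> \<pi> (s i) (t j)"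
  shows "\<not> LNG_free S T \<pi>"
proof -
  have "\<exists>i\<ge>k. \<forall>j\<le>k. \<pi> (s i) (t j)" for k
  proof -
    have "\<forall>\<^sub>F i in sequentially. \<forall>j\<in>{..k}. \<pi> (s i) (t j)"
      using hit by (intro eventually_ball_finite) auto
    then have "\<forall>\<^sub>F i in sequentially. k \<le> i \<and> (\<forall>j\<in>{..k}. \<pi> (s i) (t j))"
      by (intro eventually_conj eventually_ge_at_top)
    then show ?thesis by (auto simp: eventually_sequentially)
  qed
  then obtain i where i: "\<And>k. k \<le> i k" "\<And>j k. j \<le> k \<Longrightarrow> \<pi> (s (i k)) (t j)"
    by metis
  define m where "m n = ((\<lambda>k. Suc (i k)) ^^ n) 0" for n
  have m_Suc: "m (Suc n) = Suc (i (m n))" for n by (simp add: m_def)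
  have mono: "strict_mono m"
    using i(1) by (simp add: strict_mono_Suc_iff m_Suc less_Suc_eq_le)
  have "\<pi> (s (i (m k))) (t (m l)) \<longleftrightarrow> l \<le> k" for k l
  proof (cases "l \<le> k")
    case True
    then show ?thesis using i(2) mono by (simp add: strict_mono_less_eq)
  next
    case False
    then have "m (Suc k) \<le> m l" using mono by (simp add: strict_mono_less_eq)
    then show ?thesis using False miss by (simp add: m_Suc)
  qed
  then show ?thesis using assms(1,2) by (rule not_LNG_freeI[rotated 2])
qed

definition beating :: "('a \<Rightarrow> 'b \<Rightarrow> bool) \<Rightarrow> 'b set \<Rightarrow> 'a set \<Rightarrow> 'b set" where
  "beating \<pi> T B = {t \<in> T. \<forall>s\<in>B. \<not> \<pi> s t}"

definition hitting :: "('a \<Rightarrow> 'b \<Rightarrow> bool) \<Rightarrow> 'b set \<Rightarrow> 'a set" where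
  "hitting \<pi> F = {s. \<exists>t\<in>F. \<pi> s t}"

lemma not_LNG_free_finite_setsI:
  fixes s :: "nat \<Rightarrow> 'a" and F :: "nat \<Rightarrow> 'b set"
  assumes F: "\<And>j. finite (F j)" "\<And>j. F j \<subseteq> beating \<pi> T (s ` {..<j})"
    and s: "\<And>i. s i \<in> S \<inter> (\<Inter>j\<le>i. hitting \<pi> (F j))"
  shows "\<not> LNG_free S T \<pi>"
proof -
  have "\<forall>i j. \<exists>t. j \<le> i \<longrightarrow> t \<in> F j \<and> \<pi> (s i) t" using s by (auto simp: hitting_def)
  then obtain h where h: "\<And>i j. j \<le> i \<Longrightarrow> h i j \<in> F j \<and> \<pi> (s i) (h i j)"
    by metis
  have "\<forall>\<^sub>F i in sequentially. h i j \<in> F j" for j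
    using h by (intro eventually_sequentiallyI[of j]) simp
  then obtain r t where "strict_mono r" and t: "\<And>j. t j \<in> F j"
    and lim: "\<And>j. \<forall>\<^sub>F i in sequentially. h (r i) j = t j"
    using diagonal_eventually_const[of F h, OF F(1)] by metis
  show ?thesis
  proof (rule not_LNG_free_eventuallyI)
    show "s (r i) \<in> S" for i using s by blast
    show "t (r j) \<in> T" for j using t F(2) by (auto simp: beating_def)
    show "\<forall>\<^sub>F i in sequentially. \<pi> (s (r i)) (t (r j))" for j
      using lim[of "r j"] eventually_ge_at_top[of j]
    proof eventually_elim
      case (elim i)
      then show ?case
        using h[of "r j" "r i"] \<open>strict_mono r\<close> by (simp add: strict_mono_less_eq)
    qed
    show "\<not> \<pi> (s (r i)) (t (r j))" if "i < j" for i j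
    proof -
      have "r i < r j" using \<open>strict_mono r\<close> that by (rule strict_monoD)
      then show ?thesis using t[of "r j"] F(2)[of "r j"] by (auto simp: beating_def)
    qed
  qed
qed

lemma LNG_free_subset:
  assumes "LNG_free S T \<pi>" "S' \<subseteq> S" "T' \<subseteq> T"
  shows "LNG_free S' T' \<pi>"
  using assms unfolding LNG_free_def by (meson order_trans)

subsection \<open>Games of value zero\<close>

definition null :: "('a \<Rightarrow> 'b \<Rightarrow> bool) \<Rightarrow> 'a set \<Rightarrow> 'b set \<Rightarrow> 'a set \<Rightarrow> bool" where
  "null \<pi> S T A \<longleftrightarrow>
    (\<forall>B \<epsilon>. finite B \<longrightarrow> B \<subseteq> S \<longrightarrow> 0 < \<epsilon> \<longrightarrow> can_hold \<pi> (beating \<pi> T B) A \<epsilon>)"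

lemma beating_hitting_sequence:
  fixes \<pi> :: "'a \<Rightarrow> 'b \<Rightarrow> bool"
  assumes empty: "P {}" and "\<not> P S"
    and refine: "\<And>A B. A \<subseteq> S \<Longrightarrow> finite B \<Longrightarrow> B \<subseteq> S \<Longrightarrow> \<not> P A \<Longrightarrow>
      \<exists>F. finite F \<and> F \<subseteq> beating \<pi> T B \<and> \<not> P (A \<inter> hitting \<pi> F)"
  obtains s :: "nat \<Rightarrow> 'a" and F :: "nat \<Rightarrow> 'b set" where "\<And>n. finite (F n)"
    "\<And>n. F n \<subseteq> beating \<pi> T (s ` {..<n})" "\<And>n. s n \<in> S \<inter> (\<Inter>j\<le>n. hitting \<pi> (F j))"
proof -
  define survivors where "survivors f n = S \<inter> (\<Inter>i<n. hitting \<pi> (fst (f i)))"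
    for f :: "nat \<Rightarrow> 'b set \<times> 'a" and n
  define extends where "extends f n = (\<lambda>(F, s). finite F \<and> F \<subseteq> beating \<pi> T ((snd \<circ> f) ` {..<n}) \<and>
      s \<in> survivors f n \<inter> hitting \<pi> F \<and> \<not> P (survivors f n \<inter> hitting \<pi> F))" for f n
  have "\<exists>f. \<forall>n. extends f n (f n)"
  proof (rule dependent_wellorder_choice)
    fix r n and f g :: "nat \<Rightarrow> 'b set \<times> 'a" assume "\<And>m. m < n \<Longrightarrow> f m = g m"
    then have "survivors f n = survivors g n" "(snd \<circ> f) ` {..<n} = (snd \<circ> g) ` {..<n}"
      by (auto simp: survivors_def)
    then show "extends f n r = extends g n r" by (simp add: extends_def)
  next
    fix n and f :: "nat \<Rightarrow> 'b set \<times> 'a" assume IH: "\<And>m. m < n \<Longrightarrow> extends f m (f m)"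
    have "\<not> P (survivors f n)"
    proof (cases n)
      case 0
      then show ?thesis using \<open>\<not> P S\<close> by (simp add: survivors_def)
    next
      case (Suc m)
      then have "survivors f n = survivors f m \<inter> hitting \<pi> (fst (f m))"
        by (auto simp: survivors_def less_Suc_eq)
      then show ?thesis using IH[of m] Suc by (simp add: extends_def case_prod_beta)
    qed
    moreover have "(snd \<circ> f) ` {..<n} \<subseteq> S"
      using IH by (fastforce simp: extends_def survivors_def case_prod_beta)
    ultimately obtain F where "finite F" "F \<subseteq> beating \<pi> T ((snd \<circ> f) ` {..<n})"
      and "\<not> P (survivors f n \<inter> hitting \<pi> F)"
      using refine[of "survivors f n" "(snd \<circ> f) ` {..<n}"] by (auto simp: survivors_def)
    moreover from this(3) empty obtain s where "s \<in> survivors f n \<inter> hitting \<pi> F"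
      by (metis ex_in_conv)
    ultimately show "\<exists>r. extends f n r" by (auto simp: extends_def)
  qed
  then obtain f where f: "\<And>n. extends f n (f n)" by blast
  show thesis
  proof (rule that)
    show "finite ((fst \<circ> f) n)" "(fst \<circ> f) n \<subseteq> beating \<pi> T ((snd \<circ> f) ` {..<n})"
      "(snd \<circ> f) n \<in> S \<inter> (\<Inter>j\<le>n. hitting \<pi> ((fst \<circ> f) j))" for n
      using f[of n] by (auto simp: extends_def survivors_def case_prod_beta le_less)
  qed
qed

lemma LNG_free_induct [consumes 1, case_names empty step]:
  fixes \<pi> :: "'a \<Rightarrow> 'b \<Rightarrow> bool"
  assumes free: "LNG_free S T \<pi>" and empty: "P {}"
    and step: "\<And>A B. A \<subseteq> S \<Longrightarrow> finite B \<Longrightarrow> B \<subseteq> S \<Longrightarrow>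
      (\<And>F. finite F \<Longrightarrow> F \<subseteq> beating \<pi> T B \<Longrightarrow> P (A \<inter> hitting \<pi> F)) \<Longrightarrow> P A"
  shows "P S"
proof (rule ccontr)
  assume "\<not> P S"
  have refine: "\<exists>F. finite F \<and> F \<subseteq> beating \<pi> T B \<and> \<not> P (A \<inter> hitting \<pi> F)"
    if "A \<subseteq> S" "finite B" "B \<subseteq> S" "\<not> P A" for A B
    using step[OF that(1-3)] that(4) by blast
  show False
  proof (rule beating_hitting_sequence[of P, OF empty \<open>\<not> P S\<close> refine])
    fix s :: "nat \<Rightarrow> 'a" and F
    assume "\<And>n. finite (F n)" "\<And>n. F n \<subseteq> beating \<pi> T (s ` {..<n})"
      "\<And>n. s n \<in> S \<inter> (\<Inter>j\<le>n. hitting \<pi> (F j))"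
    then have "\<not> LNG_free S T \<pi>" by (rule not_LNG_free_finite_setsI)
    then show False using free by contradiction
  qed
qed

lemma sum_le_single_large_term:
  fixes x :: "nat \<Rightarrow> real"
  assumes "\<And>i. 0 \<le> x i" "\<And>i. x i \<le> 1" "0 \<le> \<delta>"
    and small: "\<And>i j. j < i \<Longrightarrow> 0 < x j \<Longrightarrow> x i \<le> \<delta>"
  shows "(\<Sum>i<n. x i) \<le> 1 + n * \<delta>"
proof -
  have "\<exists>k. \<forall>i. x i \<le> of_bool (i = k) + \<delta>"
  proof (cases "\<exists>k. \<delta> < x k")
    case True
    then obtain k where k: "\<delta> < x k" by blast
    have "x i \<le> of_bool (i = k) + \<delta>" for i
      using small[of k i] small[of i k] k assms(1)[of i] assms(2)[of i] assms(3)
      by (cases i k rule: linorder_cases; cases "0 < x i") auto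
    then show ?thesis by blast
  next
    case False
    then have "x i \<le> of_bool (i = 0) + \<delta>" for i by (auto simp: not_less intro: add_increasing)
    then show ?thesis by blast
  qed
  then obtain k where "\<And>i. x i \<le> of_bool (i = k) + \<delta>" by blast
  then have "(\<Sum>i<n. x i) \<le> (\<Sum>i<n. of_bool (i = k) + \<delta>)" by (intro sum_mono)
  also have "\<dots> = of_bool (k < n) + n * \<delta>" by (simp add: sum.distrib)
  also have "\<dots> \<le> 1 + n * \<delta>" by simp
  finally show ?thesis .
qed

lemma can_hold_by_averaging:
  fixes M :: "nat \<Rightarrow> 'b multiset"
  assumes M: "\<And>i. M i \<in> samples T" and "0 < \<delta>"
    and small: "\<And>s i j. s \<in> A \<Longrightarrow> j < i \<Longrightarrow> 0 < freq (\<pi> s) (M j) \<Longrightarrow> freq (\<pi> s) (M i) \<le> \<delta>"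
  shows "can_hold \<pi> T A (3 * \<delta>)"
proof -
  obtain n :: nat where "0 < n" and n: "1 / n < \<delta>"
    using \<open>0 < \<delta>\<close> by (metis ex_inverse_of_nat_less inverse_eq_divide)
  obtain M' where M': "M' \<in> samples T"
    "\<And>P. freq P M' \<le> (\<Sum>i<n. 1 / n * freq P (M i)) + \<delta>"
    using freq_mixture[of "{..<n}" "\<lambda>_. 1 / n" M T \<delta>] M \<open>0 < n\<close> \<open>0 < \<delta>\<close> by auto
  have "freq (\<pi> s) M' \<le> 3 * \<delta>" if "s \<in> A" for s
  proof -
    have "(\<Sum>i<n. freq (\<pi> s) (M i)) \<le> 1 + n * \<delta>"
      using small[OF that] \<open>0 < \<delta>\<close> by (intro sum_le_single_large_term freq_nonneg freq_le_1) auto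
    then have "(\<Sum>i<n. 1 / n * freq (\<pi> s) (M i)) \<le> 1 / n + \<delta>"
      using \<open>0 < n\<close> by (simp add: field_simps flip: sum_divide_distrib)
    then show ?thesis using M'(2)[of "\<pi> s"] n by linarith
  qed
  then show ?thesis using M'(1) by (auto simp: can_hold_def)
qed

lemma null_step:
  fixes \<pi> :: "'a \<Rightarrow> 'b \<Rightarrow> bool"
  assumes B: "finite B" "B \<subseteq> S"
    and null_hitting: "\<And>F. finite F \<Longrightarrow> F \<subseteq> beating \<pi> T B \<Longrightarrow> null \<pi> S T (A \<inter> hitting \<pi> F)"
  shows "null \<pi> S T A"
  unfolding null_def
proof (intro allI impI)
  fix B' and \<epsilon> :: real assume B': "finite B'" "B' \<subseteq> S" and "0 < \<epsilon>"
  define X where "X = beating \<pi> T (B \<union> B')"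
  have X: "X \<subseteq> beating \<pi> T B" "X \<subseteq> beating \<pi> T B'" by (auto simp: X_def beating_def)
  have "can_hold \<pi> X (A \<inter> hitting \<pi> F) (\<epsilon> / 3)" if "finite F" "F \<subseteq> X" for F
    using null_hitting[of F] that X B B' \<open>0 < \<epsilon>\<close> unfolding null_def X_def by simp
  then obtain M where M: "\<And>F. finite F \<Longrightarrow> F \<subseteq> X \<Longrightarrow>
      M F \<in> samples X \<and> (\<forall>s\<in>A \<inter> hitting \<pi> F. freq (\<pi> s) (M F) \<le> \<epsilon> / 3)"
    unfolding can_hold_def by metis
  define F where "F n = ((\<lambda>F. F \<union> set_mset (M F)) ^^ n) {}" for n
  have F_Suc: "F (Suc n) = F n \<union> set_mset (M (F n))" for n by (simp add: F_def)
  have F: "finite (F n) \<and> F n \<subseteq> X" for n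
  proof (induction n)
    case 0
    show ?case by (simp add: F_def)
  next
    case (Suc n)
    then show ?case using M[of "F n"] by (auto simp: F_Suc samples_def)
  qed
  have F_mono: "mono F" by (rule incseq_SucI) (auto simp: F_Suc)
  have "can_hold \<pi> X A (3 * (\<epsilon> / 3))"
  proof (rule can_hold_by_averaging)
    show "M (F i) \<in> samples X" for i using M F by blast
    show "0 < \<epsilon> / 3" using \<open>0 < \<epsilon>\<close> by simp
    fix s i j assume "s \<in> A" "j < i" "0 < freq (\<pi> s) (M (F j))"
    moreover have "F (Suc j) \<subseteq> F i" using \<open>j < i\<close> by (intro monoD[OF F_mono]) simp
    ultimately have "s \<in> A \<inter> hitting \<pi> (F i)"
      by (auto simp: freq_pos_iff F_Suc hitting_def)
    then show "freq (\<pi> s) (M (F i)) \<le> \<epsilon> / 3" using M F by blast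
  qed
  then show "can_hold \<pi> (beating \<pi> T B') A \<epsilon>" by (rule can_hold_mono) (use X in auto)
qed

lemma LNG_free_zero_value:
  fixes \<pi> :: "'a \<Rightarrow> 'b \<Rightarrow> bool"
  assumes free: "LNG_free S T \<pi>"
    and avoidable: "\<And>B. finite B \<Longrightarrow> B \<subseteq> S \<Longrightarrow> beating \<pi> T B \<noteq> {}" and "0 < \<epsilon>"
  shows "can_hold \<pi> T S \<epsilon>"
proof -
  have "null \<pi> S T S"
    using free
  proof (induction rule: LNG_free_induct[where P = "null \<pi> S T"])
    case empty
    have "samples (beating \<pi> T B) \<noteq> {}" if B: "finite B" "B \<subseteq> S" for B
    proof -
      obtain t where "t \<in> beating \<pi> T B" using avoidable[OF B] by blast
      then have "{#t#} \<in> samples (beating \<pi> T B)" by (simp add: samples_def)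
      then show ?thesis by blast
    qed
    then show ?case by (auto simp: null_def can_hold_def)
  next
    case (step A B)
    then show ?case by (blast intro: null_step)
  qed
  then have "can_hold \<pi> (beating \<pi> T {}) S \<epsilon>"
    unfolding null_def using \<open>0 < \<epsilon>\<close> by blast
  then show ?thesis by (simp add: beating_def)
qed

subsection \<open>Finitely additive mixtures of columns\<close>

locale probability_charge =
  fixes T :: "'b set" and l :: "'b set \<Rightarrow> real"
  assumes charge_range: "l X \<in> {0..1}"
    and charge_Un: "X \<inter> Y = {} \<Longrightarrow> l (X \<union> Y) = l X + l Y"
    and charge_total: "l T = 1"
begin

lemma charge_nonneg: "0 \<le> l X"
  using charge_range[of X] by simp

lemma charge_Int_Diff: "l X = l (X \<inter> Y) + l (X - Y)"
  using charge_Un[of "X \<inter> Y" "X - Y"] by (simp add: Int_Diff_Un Int_Diff Diff_Int_distrib)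

lemma charge_mono: "X \<subseteq> Y \<Longrightarrow> l X \<le> l Y"
  using charge_Int_Diff[of Y X] charge_nonneg[of "Y - X"] by (simp add: Int_absorb1)

lemma charge_UN_disjoint:
  assumes "finite I" "disjoint_family_on D I"
  shows "l (\<Union>i\<in>I. D i) = (\<Sum>i\<in>I. l (D i))"
  using assms
proof (induction I)
  case empty
  show ?case using charge_Un[of "{}" "{}"] by simp
next
  case (insert i I)
  then have "D i \<inter> (\<Union>i\<in>I. D i) = {}" "disjoint_family_on D I"
    by (auto simp: disjoint_family_on_insert)
  then show ?case using insert by (simp add: charge_Un)
qed

lemma charge_near_minimal_Inter:
  assumes "0 < \<eta>"
  shows "\<exists>B. finite B \<and> B \<subseteq> R \<and> (\<forall>s\<in>R. l ((T \<inter> (\<Inter>s\<in>B. X s)) - X s) \<le> \<eta>)"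
proof -
  let ?\<B> = "{B. finite B \<and> B \<subseteq> R}" and ?f = "\<lambda>B. l (T \<inter> (\<Inter>s\<in>B. X s))"
  have bdd: "bdd_below (?f ` ?\<B>)" by (intro bdd_belowI2[of _ 0]) (rule charge_nonneg)
  have "(INF B\<in>?\<B>. ?f B) < (INF B\<in>?\<B>. ?f B) + \<eta>" using \<open>0 < \<eta>\<close> by simp
  then obtain B where B: "B \<in> ?\<B>" "?f B < (INF B\<in>?\<B>. ?f B) + \<eta>"
    using cINF_less_iff[of ?\<B> ?f] bdd by blast
  have "l ((T \<inter> (\<Inter>s\<in>B. X s)) - X s) \<le> \<eta>" if "s \<in> R" for s
  proof -
    have "(INF B\<in>?\<B>. ?f B) \<le> ?f (insert s B)"
      using B(1) that by (intro cINF_lower bdd) auto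
    also have "T \<inter> (\<Inter>s\<in>insert s B. X s) = (T \<inter> (\<Inter>s\<in>B. X s)) \<inter> X s" by auto
    finally show ?thesis
      using B(2) charge_Int_Diff[of "T \<inter> (\<Inter>s\<in>B. X s)" "X s"] by linarith
  qed
  then show ?thesis using B(1) by blast
qed

lemma sum_charge_disjointed: "(\<Sum>k<n. l (disjointed C k \<inter> X)) = l ((\<Union>k<n. C k) \<inter> X)"
proof -
  have "disjoint_family_on (\<lambda>k. disjointed C k \<inter> X) {..<n}"
    using disjoint_family_disjointed[of C] by (auto simp: disjoint_family_on_def)
  then have "(\<Sum>k<n. l (disjointed C k \<inter> X)) = l (\<Union>k<n. disjointed C k \<inter> X)"
    by (intro charge_UN_disjoint[symmetric]) simp
  also have "(\<Union>k<n. disjointed C k \<inter> X) = (\<Union>k<n. C k) \<inter> X"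
    using finite_UN_disjointed_eq[of C n] by (simp add: lessThan_atLeast0)
  finally show ?thesis .
qed

lemma charge_mult_le:
  assumes "x \<le> 1" "0 \<le> \<epsilon>" "0 \<le> \<eta>" and "\<epsilon> < x \<Longrightarrow> l (D - X) \<le> \<eta>"
  shows "l D * x \<le> l D * \<epsilon> + l (D \<inter> X) + \<eta>"
proof (cases "\<epsilon> < x")
  case True
  then have "l D \<le> l (D \<inter> X) + \<eta>" using assms(4) charge_Int_Diff[of D X] by linarith
  moreover have "l D * x \<le> l D" using \<open>x \<le> 1\<close> charge_nonneg by (rule mult_left_le)
  moreover have "0 \<le> l D * \<epsilon>" using charge_nonneg \<open>0 \<le> \<epsilon>\<close> by simp
  ultimately show ?thesis by linarith
next
  case False
  then have "l D * x \<le> l D * \<epsilon>" using charge_nonneg by (intro mult_left_mono) auto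
  then show ?thesis using \<open>0 \<le> \<eta>\<close> charge_nonneg[of "D \<inter> X"] by linarith
qed

lemma can_hold_by_cover:
  fixes \<pi> :: "'a \<Rightarrow> 'b \<Rightarrow> bool" and C :: "nat \<Rightarrow> 'b set"
  assumes cover: "T \<subseteq> (\<Union>k<K. C k)" and Q: "\<And>k. Q k \<in> samples T"
    and row: "\<And>s. s \<in> S \<Longrightarrow> l {t. \<pi> s t} \<le> a"
    and dominated: "\<And>s k. s \<in> S \<Longrightarrow> \<epsilon> < freq (\<pi> s) (Q k) \<Longrightarrow> l (C k - {t. \<pi> s t}) \<le> \<eta> k"
    and \<eta>: "\<And>k. 0 \<le> \<eta> k" "(\<Sum>k<K. \<eta> k) \<le> \<epsilon>" and "0 < \<epsilon>"
  shows "can_hold \<pi> T S (a + 3 * \<epsilon>)"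
proof -
  define D where "D = disjointed C"
  have sum_1: "(\<Sum>k<K. l (D k)) = 1"
    using sum_charge_disjointed[where C = C and n = K and X = UNIV] charge_mono[OF cover] charge_total
      charge_range[of "\<Union>k<K. C k"] by (simp add: D_def)
  obtain M where M: "M \<in> samples T"
    "\<And>P. freq P M \<le> (\<Sum>k<K. l (D k) * freq P (Q k)) + \<epsilon>"
    using freq_mixture[of "{..<K}" "\<lambda>k. l (D k)" Q T \<epsilon>] charge_nonneg sum_1 Q \<open>0 < \<epsilon>\<close> by auto
  have "freq (\<pi> s) M \<le> a + 3 * \<epsilon>" if "s \<in> S" for s
  proof -
    let ?X = "{t. \<pi> s t}"
    have "l (D k - ?X) \<le> \<eta> k" if "\<epsilon> < freq (\<pi> s) (Q k)" for k
    proof -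
      have "l (D k - ?X) \<le> l (C k - ?X)"
        by (rule charge_mono) (use disjointed_subset[of C k] in \<open>auto simp: D_def\<close>)
      also have "\<dots> \<le> \<eta> k" by (rule dominated) fact+
      finally show ?thesis .
    qed
    then have "(\<Sum>k<K. l (D k) * freq (\<pi> s) (Q k)) \<le> (\<Sum>k<K. l (D k) * \<epsilon> + l (D k \<inter> ?X) + \<eta> k)"
      using \<open>0 < \<epsilon>\<close> \<eta>(1) by (intro sum_mono charge_mult_le freq_le_1) auto
    also have "\<dots> = \<epsilon> + l ((\<Union>k<K. C k) \<inter> ?X) + (\<Sum>k<K. \<eta> k)"
      by (simp add: sum.distrib sum_1 flip: sum_distrib_right) (simp add: D_def sum_charge_disjointed)
    also have "\<dots> \<le> \<epsilon> + a + \<epsilon>"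
      using charge_mono[of "(\<Union>k<K. C k) \<inter> ?X" ?X] row[OF that] \<eta>(2) by simp
    finally show ?thesis using M(2)[of "\<pi> s"] by linarith
  qed
  then show ?thesis using M(1) by (auto simp: can_hold_def)
qed

end

lemma probability_charge_freq:
  assumes "M \<in> samples T"
  shows "probability_charge T (\<lambda>X. freq (\<lambda>t. t \<in> X) M)"
proof
  show "freq (\<lambda>t. t \<in> X) M \<in> {0..1}" for X by (simp add: freq_nonneg freq_le_1)
  show "freq (\<lambda>t. t \<in> X \<union> Y) M = freq (\<lambda>t. t \<in> X) M + freq (\<lambda>t. t \<in> Y) M" if "X \<inter> Y = {}" for X Y
  proof -
    have "size (filter_mset (\<lambda>t. t \<in> X \<union> Y) M)
        = size (filter_mset (\<lambda>t. t \<in> X) M) + size (filter_mset (\<lambda>t. t \<in> Y) M)"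
      using that by (induction M) auto
    then show ?thesis by (simp add: freq_def add_divide_distrib)
  qed
  have "filter_mset (\<lambda>t. t \<in> T) M = M" using assms by (auto simp: samples_def filter_mset_eq_conv)
  then show "freq (\<lambda>t. t \<in> T) M = 1" using assms by (simp add: freq_def samples_def)
qed

lemma compact_probability_charges: "compact {l. probability_charge (T :: 'b set) l}"
proof -
  define P :: "('b set \<Rightarrow> real) set" where "P = PiE UNIV (\<lambda>_. {0..1})"
  define C :: "('b set \<Rightarrow> real) set"
    where "C = {l. (\<forall>X Y. X \<inter> Y = {} \<longrightarrow> l (X \<union> Y) = l X + l Y) \<and> l T = 1}"
  have "compactin (product_topology (\<lambda>_ :: 'b set. euclidean) UNIV) P"
    unfolding P_def compactin_PiE by simp
  then have "compact P" by (simp add: euclidean_product_topology)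
  moreover have "closed {l :: 'b set \<Rightarrow> real. X \<inter> Y = {} \<longrightarrow> l (X \<union> Y) = l X + l Y}" for X Y
    by (intro closed_Collect_imp closed_Collect_eq open_Collect_const continuous_on_add
        continuous_on_product_coordinates)
  then have "closed C"
    unfolding C_def
    by (intro closed_Collect_conj closed_Collect_all closed_Collect_eq continuous_on_const
        continuous_on_product_coordinates)
  ultimately have "compact (P \<inter> C)" by (rule compact_Int_closed)
  also have "P \<inter> C = {l. probability_charge T l}"
    by (auto simp: P_def C_def probability_charge_def PiE_def Pi_def)
  finally show ?thesis .
qed

lemma probability_charge_limit:
  fixes \<pi> :: "'a \<Rightarrow> 'b \<Rightarrow> bool"
  assumes "\<And>B. finite B \<Longrightarrow> B \<subseteq> S \<Longrightarrow> can_hold \<pi> T B a"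
  shows "\<exists>l. probability_charge T l \<and> (\<forall>s\<in>S. l {t. \<pi> s t} \<le> a)"
proof -
  define H where "H s = {l :: 'b set \<Rightarrow> real. l {t. \<pi> s t} \<le> a}" for s
  have "{l. probability_charge T l} \<inter> (\<Inter>s\<in>S. H s) \<noteq> {}"
  proof (rule compact_imp_fip_image[OF compact_probability_charges])
    show "closed (H s)" for s
      unfolding H_def
      by (intro closed_Collect_le continuous_on_const continuous_on_product_coordinates)
    fix B assume "finite B" "B \<subseteq> S"
    then obtain M where "M \<in> samples T" "\<forall>s\<in>B. freq (\<pi> s) M \<le> a"
      using assms[of B] by (auto simp: can_hold_def)
    then have "(\<lambda>X. freq (\<lambda>t. t \<in> X) M) \<in> {l. probability_charge T l} \<inter> (\<Inter>s\<in>B. H s)"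
      by (simp add: H_def probability_charge_freq)
    then show "{l. probability_charge T l} \<inter> (\<Inter>s\<in>B. H s) \<noteq> {}" by blast
  qed
  then show ?thesis by (auto simp: H_def)
qed

subsection \<open>The general upper value\<close>

lemma avoidable_selection:
  fixes \<pi> :: "'a \<Rightarrow> 'b \<Rightarrow> bool" and B :: "nat \<Rightarrow> 'a set"
  assumes "\<And>k. finite (B k)" and no_cover: "\<And>K. \<not> T \<subseteq> (\<Union>k<K. T \<inter> (\<Inter>s\<in>B k. {t. \<pi> s t}))"
  obtains f where "\<And>k. f k \<in> B k"
    "\<And>A. finite A \<Longrightarrow> A \<subseteq> range f \<Longrightarrow> beating \<pi> T A \<noteq> {}"
proof -
  have "\<exists>t\<in>T. \<forall>k<Suc i. \<exists>s\<in>B k. \<not> \<pi> s t" for i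
    using no_cover[of "Suc i"] by fastforce
  then obtain t where t: "\<And>i. t i \<in> T" "\<And>i k. k \<le> i \<Longrightarrow> \<exists>s\<in>B k. \<not> \<pi> s (t i)"
    by (metis le_imp_less_Suc)
  then have "\<forall>i k. \<exists>s. k \<le> i \<longrightarrow> s \<in> B k \<and> \<not> \<pi> s (t i)" by blast
  then obtain h where h: "\<And>i k. k \<le> i \<Longrightarrow> h i k \<in> B k \<and> \<not> \<pi> (h i k) (t i)"
    by metis
  have "\<forall>\<^sub>F i in sequentially. h i k \<in> B k" for k
    using h by (intro eventually_sequentiallyI[of k]) simp
  then obtain r f where "strict_mono r" and f: "\<And>k. f k \<in> B k"
    and lim: "\<And>k. \<forall>\<^sub>F i in sequentially. h (r i) k = f k"
    using diagonal_eventually_const[of B h, OF assms(1)] by metis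
  have missed: "\<forall>\<^sub>F i in sequentially. \<not> \<pi> (f k) (t (r i))" for k
    using lim[of k] eventually_ge_at_top[of k]
  proof eventually_elim
    case (elim i)
    then have "k \<le> r i" using seq_suble[OF \<open>strict_mono r\<close>, of i] by linarith
    then show ?case using h[of k "r i"] elim(1) by simp
  qed
  have "beating \<pi> T A \<noteq> {}" if A: "finite A" "A \<subseteq> range f" for A
  proof -
    have "\<forall>\<^sub>F i in sequentially. \<forall>s\<in>A. \<not> \<pi> s (t (r i))"
      using A missed by (intro eventually_ball_finite) auto
    then obtain i where "\<forall>s\<in>A. \<not> \<pi> s (t (r i))" by (auto simp: eventually_sequentially)
    then have "t (r i) \<in> beating \<pi> T A" using t(1) by (simp add: beating_def)
    then show ?thesis by blast
  qed
  with f show thesis by (rule that)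
qed

lemma LNG_free_finite_cover:
  fixes \<pi> :: "'a \<Rightarrow> 'b \<Rightarrow> bool" and B :: "nat \<Rightarrow> 'a set"
  assumes free: "LNG_free S T \<pi>" and "0 < \<epsilon>" and Q: "samples T \<subseteq> range Q"
    and B: "\<And>k. finite (B k)" "\<And>k. B k \<subseteq> {s \<in> S. \<epsilon> < freq (\<pi> s) (Q k)}"
  shows "\<exists>K. T \<subseteq> (\<Union>k<K. T \<inter> (\<Inter>s\<in>B k. {t. \<pi> s t}))"
proof (rule ccontr)
  assume "\<not> ?thesis"
  then obtain f where f: "\<And>k. f k \<in> B k"
    and avoidable: "\<And>A. finite A \<Longrightarrow> A \<subseteq> range f \<Longrightarrow> beating \<pi> T A \<noteq> {}"
    using avoidable_selection[of B T \<pi>] B(1) by metis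
  have "LNG_free (range f) T \<pi>"
    by (rule LNG_free_subset[OF free]) (use f B(2) in auto)
  then have "can_hold \<pi> T (range f) \<epsilon>"
    using avoidable \<open>0 < \<epsilon>\<close> by (rule LNG_free_zero_value)
  then obtain k where "\<forall>s\<in>range f. freq (\<pi> s) (Q k) \<le> \<epsilon>"
    using Q by (auto simp: can_hold_def)
  then have "freq (\<pi> (f k)) (Q k) \<le> \<epsilon>" by blast
  then show False using f[of k] B(2)[of k] by auto
qed

lemma LNG_free_can_hold_countable:
  fixes \<pi> :: "'a \<Rightarrow> 'b \<Rightarrow> bool"
  assumes free: "LNG_free S T \<pi>" and "countable T" and "a < b"
    and finite_rows: "\<And>B. finite B \<Longrightarrow> B \<subseteq> S \<Longrightarrow> can_hold \<pi> T B a"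
  shows "can_hold \<pi> T S b"
proof -
  obtain l where "probability_charge T l" and row: "\<And>s. s \<in> S \<Longrightarrow> l {t. \<pi> s t} \<le> a"
    using probability_charge_limit[of S \<pi> T a] finite_rows by blast
  then interpret probability_charge T l by simp
  define \<epsilon> where "\<epsilon> = (b - a) / 3"
  have "0 < \<epsilon>" using \<open>a < b\<close> by (simp add: \<epsilon>_def)
  have "samples T \<noteq> {}" using finite_rows[of "{}"] by (auto simp: can_hold_def)
  then obtain Q :: "nat \<Rightarrow> 'b multiset" where Q: "range Q = samples T"
    using range_from_nat_into countable_samples[OF \<open>countable T\<close>] by metis
  define R where "R k = {s \<in> S. \<epsilon> < freq (\<pi> s) (Q k)}" for k
  define C where "C B = T \<inter> (\<Inter>s\<in>B. {t. \<pi> s t})" for B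
  have "\<exists>B. finite B \<and> B \<subseteq> R k \<and> (\<forall>s\<in>R k. l (C B - {t. \<pi> s t}) \<le> \<epsilon> * (1 / 2) ^ Suc k)" for k
    unfolding C_def using \<open>0 < \<epsilon>\<close> by (intro charge_near_minimal_Inter) simp
  then obtain B where B: "\<And>k. finite (B k)" "\<And>k. B k \<subseteq> R k"
    and near_minimal: "\<And>k s. s \<in> R k \<Longrightarrow> l (C (B k) - {t. \<pi> s t}) \<le> \<epsilon> * (1 / 2) ^ Suc k"
    by metis
  obtain K where cover: "T \<subseteq> (\<Union>k<K. C (B k))"
    using LNG_free_finite_cover[OF free \<open>0 < \<epsilon>\<close>, of Q B] Q B unfolding R_def C_def by blast
  have "can_hold \<pi> T S (a + 3 * \<epsilon>)"
  proof (rule can_hold_by_cover[OF cover _ row])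
    show "Q k \<in> samples T" for k using Q by blast
    show "l (C (B k) - {t. \<pi> s t}) \<le> \<epsilon> * (1 / 2) ^ Suc k" if "s \<in> S" "\<epsilon> < freq (\<pi> s) (Q k)" for s k
      using near_minimal that by (simp add: R_def)
    have "(\<Sum>k<K. (1 / 2 :: real) ^ Suc k) = 1 - (1 / 2) ^ K" by (induction K) auto
    then show "(\<Sum>k<K. \<epsilon> * (1 / 2) ^ Suc k) \<le> \<epsilon>"
      using \<open>0 < \<epsilon>\<close> by (simp add: mult_left_le flip: sum_distrib_left power_Suc)
  qed (use \<open>0 < \<epsilon>\<close> in auto)
  moreover have "a + 3 * \<epsilon> = b" by (simp add: \<epsilon>_def field_simps)
  ultimately show ?thesis by simp
qed

lemma countable_finitary_closure:
  fixes \<Gamma> :: "'a set \<Rightarrow> 'a set"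
  assumes \<Gamma>: "\<And>F. finite F \<Longrightarrow> F \<subseteq> Z \<Longrightarrow> countable (\<Gamma> F) \<and> \<Gamma> F \<subseteq> Z"
  obtains Y where "countable Y" "Y \<subseteq> Z" "\<And>F. finite F \<Longrightarrow> F \<subseteq> Y \<Longrightarrow> \<Gamma> F \<subseteq> Y"
proof -
  define Y where "Y n = ((\<lambda>Y. Y \<union> (\<Union>F\<in>{F. finite F \<and> F \<subseteq> Y}. \<Gamma> F)) ^^ n) {}" for n
  have Y_Suc: "Y (Suc n) = Y n \<union> (\<Union>F\<in>{F. finite F \<and> F \<subseteq> Y n}. \<Gamma> F)" for n
    by (simp add: Y_def)
  have Y: "countable (Y n) \<and> Y n \<subseteq> Z" for n
  proof (induction n)
    case 0
    show ?case by (simp add: Y_def)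
  next
    case (Suc n)
    then have "countable (\<Gamma> F) \<and> \<Gamma> F \<subseteq> Z" if "finite F" "F \<subseteq> Y n" for F
      using that Suc.IH by (intro \<Gamma>) auto
    then show ?case
      using Suc countable_Collect_finite_subset[of "Y n"] by (auto simp: Y_Suc)
  qed
  have "incseq Y" by (rule incseq_SucI) (auto simp: Y_Suc)
  then have chain: "subset.chain UNIV (range Y)"
    by (auto simp: subset_chain_def) (metis incseqD linear subsetD)
  have "\<Gamma> F \<subseteq> (\<Union>n. Y n)" if F: "finite F" "F \<subseteq> (\<Union>n. Y n)" for F
  proof -
    obtain n where "F \<subseteq> Y n"
      using finite_subset_Union_chain[OF F _ chain] by auto
    then have "\<Gamma> F \<subseteq> Y (Suc n)" using F(1) by (auto simp: Y_Suc)
    then show ?thesis by blast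
  qed
  then show thesis using Y by (intro that[of "\<Union>n. Y n"]) auto
qed

lemma countable_subgame:
  assumes f: "\<And>M. M \<in> samples T \<Longrightarrow> f M \<in> S"
    and g: "\<And>B. finite B \<Longrightarrow> B \<subseteq> S \<Longrightarrow> g B \<in> samples T"
  obtains T' where "countable T'" "T' \<subseteq> T"
    "\<And>B. finite B \<Longrightarrow> B \<subseteq> f ` samples T' \<Longrightarrow> g B \<in> samples T'"
proof -
  define \<Gamma> where "\<Gamma> F = (\<Union>\<M>\<in>{\<M>. finite \<M> \<and> \<M> \<subseteq> samples F}. set_mset (g (f ` \<M>)))" for F
  have "countable (\<Gamma> F) \<and> \<Gamma> F \<subseteq> T" if F: "finite F" "F \<subseteq> T" for F
  proof
    show "countable (\<Gamma> F)"
      unfolding \<Gamma>_def using F(1)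
      by (intro countable_UN countable_Collect_finite_subset countable_samples countable_finite) auto
    have "g (f ` \<M>) \<in> samples T" if "finite \<M>" "\<M> \<subseteq> samples F" for \<M>
      using that samples_mono[OF F(2)] by (intro g image_subsetI f) auto
    then show "\<Gamma> F \<subseteq> T" by (fastforce simp: \<Gamma>_def samples_def)
  qed
  then obtain T' where T': "countable T'" "T' \<subseteq> T"
    and closed: "\<And>F. finite F \<Longrightarrow> F \<subseteq> T' \<Longrightarrow> \<Gamma> F \<subseteq> T'"
    using countable_finitary_closure[of T \<Gamma>] by metis
  have "g B \<in> samples T'" if B: "finite B" "B \<subseteq> f ` samples T'" for B
  proof -
    obtain \<M> where \<M>: "finite \<M>" "\<M> \<subseteq> samples T'" "B = f ` \<M>"
      using finite_subset_image[OF B] by blast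
    define F where "F = (\<Union>M\<in>\<M>. set_mset M)"
    have "\<M> \<subseteq> samples F" using \<M>(2) by (auto simp: samples_def F_def)
    then have "set_mset (g B) \<subseteq> \<Gamma> F" using \<M> by (auto simp: \<Gamma>_def)
    also have "\<dots> \<subseteq> T'" using \<M> by (intro closed) (auto simp: F_def samples_def)
    finally have "set_mset (g B) \<subseteq> T'" .
    moreover have "B \<subseteq> S" using B(2) f samples_mono[OF T'(2)] by blast
    then have "g B \<in> samples T" by (rule g[OF B(1)])
    ultimately show ?thesis by (simp add: samples_def)
  qed
  then show thesis by (rule that[OF T'])
qed

lemma LNG_free_can_hold:
  fixes \<pi> :: "'a \<Rightarrow> 'b \<Rightarrow> bool"
  assumes free: "LNG_free S T \<pi>" and "a < b"
    and finite_rows: "\<And>B. finite B \<Longrightarrow> B \<subseteq> S \<Longrightarrow> can_hold \<pi> T B a"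
  shows "can_hold \<pi> T S b"
proof (rule ccontr)
  assume "\<not> can_hold \<pi> T S b"
  then obtain f where f: "\<And>M. M \<in> samples T \<Longrightarrow> f M \<in> S \<and> b < freq (\<pi> (f M)) M"
    unfolding can_hold_def by (metis not_le)
  obtain g where g: "\<And>B. finite B \<Longrightarrow> B \<subseteq> S \<Longrightarrow> g B \<in> samples T \<and> (\<forall>s\<in>B. freq (\<pi> s) (g B) \<le> a)"
    using finite_rows unfolding can_hold_def by metis
  obtain T' where "countable T'" "T' \<subseteq> T"
    and closed: "\<And>B. finite B \<Longrightarrow> B \<subseteq> f ` samples T' \<Longrightarrow> g B \<in> samples T'"
    using countable_subgame[of T f S g] f g by metis
  have "samples T' \<subseteq> samples T" using \<open>T' \<subseteq> T\<close> by (rule samples_mono)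
  then have sub: "f ` samples T' \<subseteq> S" using f by blast
  have "can_hold \<pi> T' (f ` samples T') b"
  proof (rule LNG_free_can_hold_countable)
    show "LNG_free (f ` samples T') T' \<pi>" using free sub \<open>T' \<subseteq> T\<close> by (rule LNG_free_subset)
    fix B assume B: "finite B" "B \<subseteq> f ` samples T'"
    then have "\<forall>s\<in>B. freq (\<pi> s) (g B) \<le> a" using g[of B] sub by blast
    then show "can_hold \<pi> T' B a" using closed[OF B] by (auto simp: can_hold_def)
  qed fact+
  then obtain M where "M \<in> samples T'" "freq (\<pi> (f M)) M \<le> b" by (auto simp: can_hold_def)
  then show False using f[of M] \<open>samples T' \<subseteq> samples T\<close> by fastforce
qed

subsection \<open>Countably supported mixed strategies\<close>

definition expect :: "'a set \<Rightarrow> ('a \<Rightarrow> real) \<Rightarrow> ('a \<Rightarrow> real) \<Rightarrow> real" where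
  "expect X p g = (\<Sum>\<^sub>\<infinity>x\<in>X. p x * g x)"

definition uniform :: "'a multiset \<Rightarrow> 'a \<Rightarrow> real" where
  "uniform M x = count M x / size M"

lemma distr_nonneg: "p \<in> distr X \<Longrightarrow> 0 \<le> p x"
  by (simp add: distr_def)

lemma distr_has_sum: "p \<in> distr X \<Longrightarrow> (p has_sum 1) X"
  by (simp add: distr_def)

lemma distr_has_sum_const: "p \<in> distr X \<Longrightarrow> ((\<lambda>x. p x * c) has_sum c) X"
  using has_sum_cmult_left[OF distr_has_sum, of p X c] by simp

lemma distr_summable:
  assumes p: "p \<in> distr X" and g: "\<And>x. x \<in> X \<Longrightarrow> g x \<in> {0..c}"
  shows "(\<lambda>x. p x * g x) summable_on X"
proof (rule summable_on_comparison_test)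
  show "(\<lambda>x. p x * c) summable_on X"
    using distr_has_sum_const[OF p] by (rule has_sum_imp_summable)
qed (use distr_nonneg[OF p] g in \<open>auto intro: mult_left_mono\<close>)

lemma expect_le:
  assumes p: "p \<in> distr X" and g: "\<And>x. x \<in> X \<Longrightarrow> g x \<in> {0..c}"
  shows "expect X p g \<le> c"
  unfolding expect_def
  by (rule has_sum_mono[OF has_sum_infsum[OF distr_summable[OF p g]] distr_has_sum_const[OF p]])
    (use distr_nonneg[OF p] g in \<open>auto intro: mult_left_mono\<close>)

lemma expect_ge:
  assumes p: "p \<in> distr X" and g: "\<And>x. x \<in> X \<Longrightarrow> g x \<in> {0..d}" "\<And>x. x \<in> X \<Longrightarrow> c \<le> g x"
  shows "c \<le> expect X p g"
  unfolding expect_def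
  by (rule has_sum_mono[OF distr_has_sum_const[OF p] has_sum_infsum[OF distr_summable[OF p g(1)]]])
    (use distr_nonneg[OF p] g in \<open>auto intro: mult_left_mono\<close>)

lemma expect_of_bool_in: "p \<in> distr X \<Longrightarrow> expect X p (\<lambda>x. of_bool (P x)) \<in> {0..1}"
  using expect_le[of p X "\<lambda>x. of_bool (P x)" 1] expect_ge[of p X "\<lambda>x. of_bool (P x)" 1 0] by auto

lemma expect_of_bool_not:
  assumes "p \<in> distr X"
  shows "expect X p (\<lambda>x. of_bool (\<not> P x)) = 1 - expect X p (\<lambda>x. of_bool (P x))"
proof -
  have "expect X p (\<lambda>x. of_bool (P x)) + expect X p (\<lambda>x. of_bool (\<not> P x))
      = (\<Sum>\<^sub>\<infinity>x\<in>X. p x * of_bool (P x) + p x * of_bool (\<not> P x))"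
    unfolding expect_def by (intro infsum_add[symmetric] distr_summable[OF assms, of _ 1]) auto
  also have "\<dots> = infsum p X" by (intro infsum_cong) auto
  also have "\<dots> = 1" using distr_has_sum[OF assms] by (rule infsumI)
  finally show ?thesis by simp
qed

lemma expect_finite_support:
  assumes "finite F" "F \<subseteq> X" "\<And>x. x \<notin> F \<Longrightarrow> p x = 0"
  shows "expect X p g = (\<Sum>x\<in>F. p x * g x)"
  unfolding expect_def by (rule infsumI, rule has_sum_finite_neutralI[of F]) (use assms in auto)

lemma distr_finite_support:
  assumes F: "finite F" "F \<subseteq> X" and p: "\<And>x. 0 \<le> p x" "\<And>x. x \<notin> F \<Longrightarrow> p x = 0" "sum p F = 1"
  shows "p \<in> distr X"
proof -
  have "{x. p x \<noteq> 0} \<subseteq> F" using p(2) by blast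
  then have "countable {x. p x \<noteq> 0}" using F(1) by (meson countable_finite finite_subset)
  moreover have "(p has_sum 1) X"
    using assms by (intro has_sum_finite_neutralI[of F]) auto
  ultimately show ?thesis using F p by (auto simp: distr_def)
qed

lemma sum_uniform_of_bool: "(\<Sum>x\<in>set_mset M. uniform M x * of_bool (P x)) = freq P M"
proof -
  have "real (size (filter_mset P M)) = (\<Sum>x\<in>set_mset (filter_mset P M). real (count M x))"
    unfolding size_multiset_overloaded_eq of_nat_sum by (intro sum.cong) auto
  also have "\<dots> = (\<Sum>x\<in>set_mset M. real (count M x) * of_bool (P x))"
    by (intro sum.mono_neutral_cong_left) auto
  finally show ?thesis
    by (simp only: freq_def uniform_def sum_divide_distrib times_divide_eq_left)
qed

lemma uniform_in_distr:
  assumes "M \<in> samples X"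
  shows "uniform M \<in> distr X"
proof (rule distr_finite_support[of "set_mset M"])
  show "sum (uniform M) (set_mset M) = 1"
    using sum_uniform_of_bool[of M "\<lambda>_. True"] assms by (simp add: freq_def samples_def)
qed (use assms in \<open>auto simp: uniform_def samples_def not_in_iff\<close>)

lemma expect_uniform_of_bool:
  assumes "M \<in> samples X"
  shows "expect X (uniform M) (\<lambda>x. of_bool (P x)) = freq P M"
proof -
  have "expect X (uniform M) (\<lambda>x. of_bool (P x)) = (\<Sum>x\<in>set_mset M. uniform M x * of_bool (P x))"
    using assms by (intro expect_finite_support) (auto simp: uniform_def samples_def not_in_iff)
  then show ?thesis by (simp only: sum_uniform_of_bool)
qed

lemma singleton_in_samples: "x \<in> X \<Longrightarrow> {#x#} \<in> samples X"
  by (simp add: samples_def)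

lemma expect_singleton: "x \<in> X \<Longrightarrow> expect X (uniform {#x#}) g = g x"
  by (subst expect_finite_support[of "{x}"]) (auto simp: uniform_def)

lemma distr_nonempty: "X \<noteq> {} \<Longrightarrow> distr X \<noteq> {}"
  by (metis ex_in_conv uniform_in_distr singleton_in_samples)

lemma mix_summable:
  assumes p: "p \<in> distr S" and q: "q \<in> distr T"
  shows "(\<lambda>(s, t). p s * q t * of_bool (\<pi> s t)) summable_on S \<times> T"
proof (rule summable_on_comparison_test)
  show "(\<lambda>(s, t). p s * q t) summable_on S \<times> T"
    using has_sum_cmult_right[OF distr_has_sum[OF q]] has_sum_imp_summable[OF distr_has_sum[OF p]]
      distr_nonneg[OF p] distr_nonneg[OF q]
    by (intro summable_on_SigmaI[where g = p]) fastforce+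
qed (use distr_nonneg[OF p] distr_nonneg[OF q] in auto)

lemma mix_eq_expect_rows:
  assumes "p \<in> distr S" "q \<in> distr T"
  shows "mix \<pi> S T p q = expect S p (\<lambda>s. expect T q (\<lambda>t. of_bool (\<pi> s t)))"
  unfolding mix_def infsum_Sigma'_banach[OF mix_summable[OF assms], symmetric]
  by (simp add: expect_def mult.assoc infsum_cmult_right')

lemma mix_eq_expect_columns:
  assumes "p \<in> distr S" "q \<in> distr T"
  shows "mix \<pi> S T p q = expect T q (\<lambda>t. expect S p (\<lambda>s. of_bool (\<pi> s t)))"
  unfolding mix_def infsum_Sigma'_banach[OF mix_summable[OF assms], symmetric]
    infsum_swap_banach[OF mix_summable[OF assms]] expect_def infsum_cmult_right'[symmetric]
  by (intro infsum_cong) simp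

lemma mix_nonneg: "p \<in> distr S \<Longrightarrow> q \<in> distr T \<Longrightarrow> 0 \<le> mix \<pi> S T p q"
  using expect_ge[of p S "\<lambda>s. expect T q (\<lambda>t. of_bool (\<pi> s t))" 1 0] expect_of_bool_in[of q T]
  by (simp add: mix_eq_expect_rows)

lemma mix_le_1: "p \<in> distr S \<Longrightarrow> q \<in> distr T \<Longrightarrow> mix \<pi> S T p q \<le> 1"
  using expect_le[of p S "\<lambda>s. expect T q (\<lambda>t. of_bool (\<pi> s t))" 1] expect_of_bool_in[of q T]
  by (simp add: mix_eq_expect_rows)

subsection \<open>The lower and the upper value\<close>

definition lower_value :: "'a set \<Rightarrow> 'b set \<Rightarrow> ('a \<Rightarrow> 'b \<Rightarrow> bool) \<Rightarrow> real" where
  "lower_value S T \<pi> = (SUP p\<in>distr S. INF q\<in>distr T. mix \<pi> S T p q)"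

definition upper_value :: "'a set \<Rightarrow> 'b set \<Rightarrow> ('a \<Rightarrow> 'b \<Rightarrow> bool) \<Rightarrow> real" where
  "upper_value S T \<pi> = (INF q\<in>distr T. SUP p\<in>distr S. mix \<pi> S T p q)"

lemma INF_mix_le:
  "p \<in> distr S \<Longrightarrow> q \<in> distr T \<Longrightarrow> (INF q\<in>distr T. mix \<pi> S T p q) \<le> mix \<pi> S T p q"
  by (intro cINF_lower bdd_belowI2[of _ 0] mix_nonneg)

lemma le_SUP_mix:
  "p \<in> distr S \<Longrightarrow> q \<in> distr T \<Longrightarrow> mix \<pi> S T p q \<le> (SUP p\<in>distr S. mix \<pi> S T p q)"
  by (intro cSUP_upper bdd_aboveI2[of _ _ 1] mix_le_1)

lemma lower_value_le:
  assumes "S \<noteq> {}"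
    and response: "\<And>p. p \<in> distr S \<Longrightarrow> \<exists>t\<in>T. expect S p (\<lambda>s. of_bool (\<pi> s t)) \<le> c"
  shows "lower_value S T \<pi> \<le> c"
  unfolding lower_value_def
proof (rule cSUP_least[OF distr_nonempty[OF \<open>S \<noteq> {}\<close>]])
  fix p assume p: "p \<in> distr S"
  then obtain t where t: "t \<in> T" "expect S p (\<lambda>s. of_bool (\<pi> s t)) \<le> c" using response by blast
  have q: "uniform {#t#} \<in> distr T" by (intro uniform_in_distr singleton_in_samples t)
  show "(INF q\<in>distr T. mix \<pi> S T p q) \<le> c"
    using INF_mix_le[OF p q, of \<pi>] t by (simp add: mix_eq_expect_columns[OF p q] expect_singleton)
qed

lemma le_upper_value:
  assumes "T \<noteq> {}"
    and response: "\<And>q. q \<in> distr T \<Longrightarrow> \<exists>s\<in>S. c \<le> expect T q (\<lambda>t. of_bool (\<pi> s t))"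
  shows "c \<le> upper_value S T \<pi>"
  unfolding upper_value_def
proof (rule cINF_greatest[OF distr_nonempty[OF \<open>T \<noteq> {}\<close>]])
  fix q assume q: "q \<in> distr T"
  then obtain s where s: "s \<in> S" "c \<le> expect T q (\<lambda>t. of_bool (\<pi> s t))" using response by blast
  have p: "uniform {#s#} \<in> distr S" by (intro uniform_in_distr singleton_in_samples s)
  show "c \<le> (SUP p\<in>distr S. mix \<pi> S T p q)"
    using le_SUP_mix[OF p q, of \<pi>] s by (simp add: mix_eq_expect_rows[OF p q] expect_singleton)
qed

lemma le_lower_value:
  assumes "T \<noteq> {}" and p: "p \<in> distr S"
    and guarantee: "\<And>t. t \<in> T \<Longrightarrow> c \<le> expect S p (\<lambda>s. of_bool (\<pi> s t))"
  shows "c \<le> lower_value S T \<pi>"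
proof -
  obtain q\<^sub>0 where "q\<^sub>0 \<in> distr T" using distr_nonempty[OF \<open>T \<noteq> {}\<close>] by blast
  then have "(INF q\<in>distr T. mix \<pi> S T p q) \<le> 1" if "p \<in> distr S" for p
    using order_trans[OF INF_mix_le mix_le_1] that by blast
  then have "bdd_above ((\<lambda>p. INF q\<in>distr T. mix \<pi> S T p q) ` distr S)" by (rule bdd_aboveI2)
  moreover have "c \<le> (INF q\<in>distr T. mix \<pi> S T p q)"
  proof (rule cINF_greatest[OF distr_nonempty[OF \<open>T \<noteq> {}\<close>]])
    fix q assume q: "q \<in> distr T"
    show "c \<le> mix \<pi> S T p q"
      unfolding mix_eq_expect_columns[OF p q]
      by (rule expect_ge[OF q expect_of_bool_in[OF p] guarantee])
  qed
  ultimately show ?thesis unfolding lower_value_def by (intro cSUP_upper2[OF _ p])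
qed

lemma upper_value_le:
  assumes "S \<noteq> {}" and q: "q \<in> distr T"
    and guarantee: "\<And>s. s \<in> S \<Longrightarrow> expect T q (\<lambda>t. of_bool (\<pi> s t)) \<le> c"
  shows "upper_value S T \<pi> \<le> c"
proof -
  obtain p\<^sub>0 where "p\<^sub>0 \<in> distr S" using distr_nonempty[OF \<open>S \<noteq> {}\<close>] by blast
  then have "0 \<le> (SUP p\<in>distr S. mix \<pi> S T p q)" if "q \<in> distr T" for q
    using order_trans[OF mix_nonneg le_SUP_mix] that by blast
  then have "bdd_below ((\<lambda>q. SUP p\<in>distr S. mix \<pi> S T p q) ` distr T)" by (rule bdd_belowI2)
  moreover have "(SUP p\<in>distr S. mix \<pi> S T p q) \<le> c"
  proof (rule cSUP_least[OF distr_nonempty[OF \<open>S \<noteq> {}\<close>]])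
    fix p assume p: "p \<in> distr S"
    have "expect T q (\<lambda>t. of_bool (\<pi> s t)) \<in> {0..c}" if "s \<in> S" for s
      using guarantee[OF that] expect_of_bool_in[OF q, of "\<pi> s"] by simp
    then show "mix \<pi> S T p q \<le> c"
      unfolding mix_eq_expect_rows[OF p q] by (rule expect_le[OF p])
  qed
  ultimately show ?thesis unfolding upper_value_def by (intro cINF_lower2[OF _ q])
qed

lemma lower_value_le_upper_value:
  assumes "S \<noteq> {}" "T \<noteq> {}"
  shows "lower_value S T \<pi> \<le> upper_value S T \<pi>"
  unfolding lower_value_def upper_value_def
  by (intro cSUP_least cINF_greatest distr_nonempty assms) (rule order_trans[OF INF_mix_le le_SUP_mix])

lemma can_hold_finite_rows:
  fixes \<pi> :: "'a \<Rightarrow> 'b \<Rightarrow> bool"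
  assumes "T \<noteq> {}" and B: "finite B" "B \<subseteq> S" and "lower_value S T \<pi> < c"
  shows "can_hold \<pi> T B c"
proof -
  obtain a where a: "lower_value S T \<pi> < a" "a < c" using dense[OF assms(4)] by blast
  show ?thesis
  proof (rule finite_rows_minimax[OF B(1) \<open>T \<noteq> {}\<close> a(2)])
    fix p :: "'a \<Rightarrow> real" assume p: "\<And>s. s \<in> B \<Longrightarrow> 0 \<le> p s" "sum p B = 1"
    define p' where "p' s = (if s \<in> B then p s else 0)" for s
    have "p' \<in> distr S"
      by (rule distr_finite_support[OF B]) (use p in \<open>auto simp: p'_def\<close>)
    then obtain t where "t \<in> T" "expect S p' (\<lambda>s. of_bool (\<pi> s t)) < a"
      using le_lower_value[OF \<open>T \<noteq> {}\<close>, of p' S a \<pi>] a(1) by fastforce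
    moreover have "expect S p' (\<lambda>s. of_bool (\<pi> s t)) = (\<Sum>s\<in>B. p s * of_bool (\<pi> s t))"
      by (subst expect_finite_support[OF B]) (auto simp: p'_def)
    ultimately show "\<exists>t\<in>T. (\<Sum>s\<in>B. p s * of_bool (\<pi> s t)) \<le> a"
      by (intro bexI[of _ t]) simp_all
  qed
qed

lemma upper_value_le_if_can_hold:
  assumes "S \<noteq> {}" "can_hold \<pi> T S c"
  shows "upper_value S T \<pi> \<le> c"
proof -
  obtain M where M: "M \<in> samples T" "\<And>s. s \<in> S \<Longrightarrow> freq (\<pi> s) M \<le> c"
    using assms(2) by (auto simp: can_hold_def)
  then show ?thesis
    by (intro upper_value_le[OF \<open>S \<noteq> {}\<close> uniform_in_distr]) (auto simp: expect_uniform_of_bool)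
qed

lemma LNG_free_imp_minimax:
  fixes \<pi> :: "'a \<Rightarrow> 'b \<Rightarrow> bool"
  assumes "S \<noteq> {}" "T \<noteq> {}" "LNG_free S T \<pi>"
  shows "minimax_property S T \<pi>"
proof -
  have "upper_value S T \<pi> \<le> lower_value S T \<pi>"
  proof (rule dense_ge)
    fix b assume b: "lower_value S T \<pi> < b"
    obtain a where "lower_value S T \<pi> < a" "a < b" using dense[OF b] by blast
    from this(1) have "can_hold \<pi> T B a" if "finite B" "B \<subseteq> S" for B
      using can_hold_finite_rows[OF \<open>T \<noteq> {}\<close> that] by blast
    then have "can_hold \<pi> T S b" by (rule LNG_free_can_hold[OF assms(3) \<open>a < b\<close>])
    then show "upper_value S T \<pi> \<le> b" by (rule upper_value_le_if_can_hold[OF \<open>S \<noteq> {}\<close>])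
  qed
  then show ?thesis
    using lower_value_le_upper_value[OF assms(1,2), of \<pi>]
    by (simp add: minimax_property_def lower_value_def upper_value_def)
qed

subsection \<open>The larger number game\<close>

lemma distr_range_tail:
  fixes s :: "nat \<Rightarrow> 'a"
  assumes p: "p \<in> distr (range s)" and "0 < \<epsilon>"
  obtains N where "\<And>P. (\<And>i. i < N \<Longrightarrow> P (s i)) \<Longrightarrow> 1 - \<epsilon> \<le> expect (range s) p (\<lambda>x. of_bool (P x))"
proof -
  obtain F where F: "finite F" "F \<subseteq> range s" "dist (sum p F) 1 \<le> \<epsilon>"
    using has_sum_finite_approximation[OF distr_has_sum[OF p] \<open>0 < \<epsilon>\<close>] by blast
  obtain J where J: "finite J" "F = s ` J" using finite_subset_image[OF F(1,2)] by auto
  then obtain N where N: "J \<subseteq> {..<N}" using finite_nat_bounded by blast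
  show thesis
  proof (rule that)
    fix P assume "\<And>i. i < N \<Longrightarrow> P (s i)"
    then have "sum p F = (\<Sum>x\<in>F. p x * of_bool (P x))" using N J(2) by (intro sum.cong) auto
    also have "\<dots> \<le> expect (range s) p (\<lambda>x. of_bool (P x))"
      unfolding expect_def using F(1,2) distr_nonneg[OF p]
      by (intro finite_sum_le_infsum distr_summable[OF p, of _ 1]) auto
    finally show "1 - \<epsilon> \<le> expect (range s) p (\<lambda>x. of_bool (P x))"
      using F(3) by (simp add: dist_real_def)
  qed
qed

lemma LNG_not_minimax:
  fixes s :: "nat \<Rightarrow> 'a" and t :: "nat \<Rightarrow> 'b"
  assumes \<pi>: "\<And>i j. \<pi> (s i) (t j) \<longleftrightarrow> j \<le> i"
  shows "\<not> minimax_property (range s) (range t) \<pi>"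
proof -
  have "lower_value (range s) (range t) \<pi> \<le> 1 / 3"
  proof (rule lower_value_le)
    fix p assume p: "p \<in> distr (range s)"
    obtain N where "\<And>P. (\<And>i. i < N \<Longrightarrow> P (s i)) \<Longrightarrow>
        1 - 1 / 3 \<le> expect (range s) p (\<lambda>x. of_bool (P x))"
      using distr_range_tail[OF p, of "1 / 3"] by auto
    then have "1 - 1 / 3 \<le> expect (range s) p (\<lambda>x. of_bool (\<not> \<pi> x (t N)))" using \<pi> by simp
    then show "\<exists>y\<in>range t. expect (range s) p (\<lambda>x. of_bool (\<pi> x y)) \<le> 1 / 3"
      by (auto simp: expect_of_bool_not[OF p])
  qed simp
  moreover have "1 - 1 / 3 \<le> upper_value (range s) (range t) \<pi>"
  proof (rule le_upper_value)
    fix q assume q: "q \<in> distr (range t)"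
    obtain N where "\<And>P. (\<And>i. i < N \<Longrightarrow> P (t i)) \<Longrightarrow>
        1 - 1 / 3 \<le> expect (range t) q (\<lambda>x. of_bool (P x))"
      using distr_range_tail[OF q, of "1 / 3"] by auto
    then have "1 - 1 / 3 \<le> expect (range t) q (\<lambda>y. of_bool (\<pi> (s N) y))" using \<pi> by simp
    then show "\<exists>x\<in>range s. 1 - 1 / 3 \<le> expect (range t) q (\<lambda>y. of_bool (\<pi> x y))" by blast
  qed simp
  ultimately show ?thesis
    by (simp add: minimax_property_def lower_value_def upper_value_def)
qed

theorem theorem3p1:
  fixes S :: "'a set" and T :: "'b set" and \<pi> :: "'a \<Rightarrow> 'b \<Rightarrow> bool"
  assumes "S \<noteq> {}" and "T \<noteq> {}"
  shows "totally_minimax S T \<pi> \<longleftrightarrow> LNG_free S T \<pi>"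
proof
  assume minimax: "totally_minimax S T \<pi>"
  show "LNG_free S T \<pi>"
    unfolding LNG_free_def
  proof (intro notI, elim exE conjE)
    fix s :: "nat \<Rightarrow> 'a" and t :: "nat \<Rightarrow> 'b"
    assume "range s \<subseteq> S" "range t \<subseteq> T" and pattern: "\<forall>i j. \<pi> (s i) (t j) \<longleftrightarrow> j \<le> i"
    then have "minimax_property (range s) (range t) \<pi>"
      using minimax by (simp add: totally_minimax_def)
    then show False using LNG_not_minimax[of \<pi> s t] pattern by blast
  qed
next
  assume "LNG_free S T \<pi>"
  then show "totally_minimax S T \<pi>"
    unfolding totally_minimax_def by (blast intro: LNG_free_imp_minimax LNG_free_subset)
qed

end
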